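(* (1) For every integer $k\ge 6$, $B\le C_k$. (2) For $k\in\{3,4,5\}$, $B\not\le C_k$.
   Context: All graphs are finite and simple, considered up to isomorphism. An edge-colored graph is a pair $(G,c)$ with $c\colon E(G)\to\mathbb{N}$ an arbitrary map (not necessarily proper); it is colored in $t$ or more colors if $|c(E(G))|\ge t$. A subgraph (not necessarily induced) is rainbow if its edges receive pairwise distinct colors. $(G,c)$ is rainbow $H$-free if $G$ contains no rainbow subgraph isomorphic to $H$. For graphs $H_1,H_2$, write $H_1\le H_2$ if there is a positive integer $t$ such that every rainbow $H_1$-free edge-colored complete graph colored in $t$ or more colors is rainbow $H_2$-free. $C_k$ is the cycle on $k$ vertices. The barbell $B$ is the unique tree with degree sequence $(3,3,1,1,1,1)$: two adjacent vertices, each adjacent to two further leaves. *)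

theory Defs
  imports Main
begin

datatype 'a graph = Graph (verts: "'a set") (edges: "'a set set")

text \<open>Edges are two-element sets of vertices.\<close>

definition simple_graph :: "'a graph \<Rightarrow> bool" where
  "simple_graph G \<longleftrightarrow> finite (verts G) \<and> (\<forall>e\<in>edges G. e \<subseteq> verts G \<and> card e = 2)"

definition complete_graph :: "'a graph \<Rightarrow> bool" where
  "complete_graph G \<longleftrightarrow> finite (verts G) \<and> edges G = {e. e \<subseteq> verts G \<and> card e = 2}"

definition subgraph :: "'a graph \<Rightarrow> 'a graph \<Rightarrow> bool" where
  "subgraph S G \<longleftrightarrow> simple_graph S \<and> verts S \<subseteq> verts G \<and> edges S \<subseteq> edges G"

definition isomorphic :: "'a graph \<Rightarrow> 'b graph \<Rightarrow> bool" where
  "isomorphic G H \<longleftrightarrow>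
     (\<exists>f. bij_betw f (verts G) (verts H) \<and> (\<lambda>e. f ` e) ` edges G = edges H)"

text \<open>A coloring is a function on all sets of vertices; only its values on the edges of the
  graph at hand are ever used.\<close>

definition rainbow :: "('a set \<Rightarrow> nat) \<Rightarrow> 'a graph \<Rightarrow> bool" where
  "rainbow c S \<longleftrightarrow> inj_on c (edges S)"

definition rainbow_free :: "'b graph \<Rightarrow> 'a graph \<Rightarrow> ('a set \<Rightarrow> nat) \<Rightarrow> bool" where
  "rainbow_free H G c \<longleftrightarrow> \<not> (\<exists>S. subgraph S G \<and> isomorphic S H \<and> rainbow c S)"

text \<open>Graphs are considered up to isomorphism, so it suffices to let the finite complete host
  graphs have natural numbers as vertices.\<close>

definition rainbow_le :: "'a graph \<Rightarrow> 'b graph \<Rightarrow> bool" (infix "\<preceq>" 50) where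
  "H1 \<preceq> H2 \<longleftrightarrow>
     (\<exists>t::nat. t > 0 \<and>
       (\<forall>(G :: nat graph) c. complete_graph G \<and> card (c ` edges G) \<ge> t \<and> rainbow_free H1 G c
          \<longrightarrow> rainbow_free H2 G c))"

text \<open>This is the cycle on \<open>k\<close> vertices only for \<open>k \<ge> 3\<close>.\<close>

definition cycle_graph :: "nat \<Rightarrow> nat graph" where
  "cycle_graph k = Graph {..<k} ((\<lambda>i. {i, (i + 1) mod k}) ` {..<k})"

text \<open>The central vertices are 0 and 1.\<close>

definition barbell :: "nat graph" where
  "barbell = Graph {..<6} {{0, 1}, {0, 2}, {0, 3}, {1, 4}, {1, 5}}"

lemma simple_graph_complete: "complete_graph G \<Longrightarrow> simple_graph G"
  by (simp add: complete_graph_def simple_graph_def)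

lemma simple_graph_cycle:
  assumes "k \<ge> 3"
  shows "simple_graph (cycle_graph k)"
  using assms by (auto simp: simple_graph_def cycle_graph_def mod_Suc)

lemma simple_graph_barbell: "simple_graph barbell"
  by (auto simp: simple_graph_def barbell_def)

end

theory Submission
  imports Defs
begin

text \<open>
  Let \<open>w i\<close> run around a rainbow cycle of length at least 6 in a complete graph without rainbow
  barbell, and let \<open>C i\<close> be the color of \<open>w i w (i + 1)\<close>. If a vertex \<open>u\<close> sees at least 7 colors,
  then every barbell with center \<open>u x\<close> can be completed at \<open>u\<close>, so the edges from \<open>x\<close> that avoid \<open>u\<close>
  have at most one color besides that of \<open>u x\<close>; for \<open>u = w i\<close> this leaves no color for the chord
  \<open>w (i + 2) w (i + 4)\<close>. Hence at most 6 colors occur at each cycle vertex, and with more than \<open>6 k\<close>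
  colors some edge \<open>a b\<close> has a color that occurs nowhere at the cycle. Barbells centered at the
  chords \<open>w i w (i + 3)\<close> and at the edges \<open>w i a\<close> then show that \<open>w i a\<close> has one of the two cycle
  colors at \<open>w i\<close>, and a barbell with center \<open>w i a\<close> and leaf edges \<open>w i w (i + 3)\<close>, \<open>a b\<close> gives the
  contradiction.

  For \<open>k \<le> 5\<close>, color a \<open>k\<close>-cycle and a large matching disjoint from it with distinct colors, and all
  other edges with one further color. Both centers of a rainbow barbell have degree 3, so its central
  edge has the further color, and its two disjoint paths on three vertices lie in the cycle, which is
  too short.
\<close>

section \<open>Colors at a rainbow cycle\<close>

text \<open>The cycle is given by the periodic sequence of its vertices; of the length \<open>k \<ge> 6\<close> only the
  injectivity on windows of six consecutive vertices or edges is needed.\<close>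

locale rainbow_cycle =
  fixes V :: "'a set" and g :: "'a \<Rightarrow> 'a \<Rightarrow> 'b" and w :: "int \<Rightarrow> 'a"
  assumes sym: "g x y = g y x"
    and no_barbell: "\<lbrakk>{x, y, p, q, r, s} \<subseteq> V; distinct [x, y, p, q, r, s]\<rbrakk>
      \<Longrightarrow> \<not> distinct [g x y, g x p, g x q, g y r, g y s]"
    and w_in [simp]: "w i \<in> V"
    and w_eq [simp]: "\<lbrakk>i < j + 6; j < i + 6\<rbrakk> \<Longrightarrow> w i = w j \<longleftrightarrow> i = j"
    and color_eq: "\<lbrakk>i < j + 6; j < i + 6\<rbrakk>
      \<Longrightarrow> g (w i) (w (i + 1)) = g (w j) (w (j + 1)) \<longleftrightarrow> i = j"
begin

definition C :: "int \<Rightarrow> 'b" where "C i = g (w i) (w (i + 1))"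

lemma C_eq [simp]: "\<lbrakk>i < j + 6; j < i + 6\<rbrakk> \<Longrightarrow> C i = C j \<longleftrightarrow> i = j"
  by (simp add: C_def color_eq)

lemma color_next: "j = i + 1 \<Longrightarrow> g (w i) (w j) = C i"
  by (simp add: C_def)

lemma color_prev: "j = i - 1 \<Longrightarrow> g (w i) (w j) = C j"
  using sym[of "w i" "w j"] by (simp add: C_def)

text \<open>Otherwise \<open>g u x\<close>, \<open>g x y\<close>, \<open>g x z\<close> are distinct.
  Of the 7 colors at \<open>u\<close>, at least two avoid the five in \<open>?F\<close>; excluding
  \<open>g u x\<close>, \<open>g u y\<close>, \<open>g u z\<close> keeps their ends
  \<open>p\<close>, \<open>q\<close> off \<open>x\<close>, \<open>y\<close>, \<open>z\<close>, so
  the barbell with center \<open>u x\<close> is rainbow.\<close>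

lemma many_colors_imp:
  assumes "finite V" "u \<in> V" "card (g u ` (V - {u})) \<ge> 7"
    and "x \<in> V" "y \<in> V" "z \<in> V" "distinct [u, x, y, z]" and "g x y \<noteq> g x z"
  shows "g u x = g x y \<or> g u x = g x z"
proof (rule ccontr)
  assume neg: "\<not> ?thesis"
  let ?K = "g u ` (V - {u})"
  let ?F = "set [g u x, g x y, g x z, g u y, g u z]"
  have "card ?F \<le> 5"
    using card_length[of "[g u x, g x y, g x z, g u y, g u z]"] by simp
  then have "card (?K - ?F) \<ge> 2"
    using diff_card_le_card_Diff[of ?F ?K] assms(3) by simp
  then obtain T where T: "T \<subseteq> ?K - ?F" "card T = 2"
    using obtain_subset_with_card_n by metis
  obtain n1 n2 where n: "T = {n1, n2}" "n1 \<noteq> n2"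
    using T(2) by (auto simp: card_2_iff)
  obtain p q where p: "p \<in> V" "p \<noteq> u" "g u p = n1" and q: "q \<in> V" "q \<noteq> u" "g u q = n2"
    using T(1) n by auto
  have "\<not> distinct [g u x, g u p, g u q, g x y, g x z]"
    using assms p q T(1) n by (intro no_barbell) auto
  then show False
    using assms p q T(1) n neg by auto
qed

lemma few_colors_at_cycle:
  assumes "finite V"
  shows "card (g (w i) ` (V - {w i})) \<le> 6"
proof (rule ccontr)
  assume "\<not> ?thesis"
  then have K: "card (g (w i) ` (V - {w i})) \<ge> 7" by simp
  note star = many_colors_imp[OF assms w_in K]
  \<comment> \<open>Both ends of this chord and their cycle neighbors differ from
    \<open>w i\<close>. The two cycle edges at either end have distinct colors, so
    \<open>star\<close> confines the chord to those two colors; the pairs at the two ends are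
    disjoint.\<close>
  let ?x = "w (i + 2)" and ?y = "w (i + 4)"
  have cols: "g ?x (w (i + 1)) = C (i + 1)" "g ?x (w (i + 3)) = C (i + 2)"
    "g ?y (w (i + 3)) = C (i + 3)" "g ?y (w (i + 5)) = C (i + 4)" "g ?y ?x = g ?x ?y"
    using sym[of ?y ?x] by (simp_all add: color_next color_prev)
  have "g (w i) ?x = C (i + 1) \<or> g (w i) ?x = C (i + 2)"
    using star[of ?x "w (i + 1)" "w (i + 3)"] by (simp add: cols)
  moreover have "C (i + 1) = g ?x ?y \<or> g (w i) ?x = C (i + 1) \<or> g (w i) ?x = g ?x ?y"
    using star[of ?x "w (i + 1)" ?y] by (auto simp: cols)
  moreover have "C (i + 2) = g ?x ?y \<or> g (w i) ?x = C (i + 2) \<or> g (w i) ?x = g ?x ?y"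
    using star[of ?x "w (i + 3)" ?y] by (auto simp: cols)
  moreover have "C (i + 1) \<noteq> C (i + 2)" by simp
  ultimately have 1: "g ?x ?y \<in> {C (i + 1), C (i + 2)}" by (metis insertCI)
  have "g (w i) ?y = C (i + 3) \<or> g (w i) ?y = C (i + 4)"
    using star[of ?y "w (i + 3)" "w (i + 5)"] by (simp add: cols)
  moreover have "C (i + 3) = g ?x ?y \<or> g (w i) ?y = C (i + 3) \<or> g (w i) ?y = g ?x ?y"
    using star[of ?y "w (i + 3)" ?x] by (auto simp: cols)
  moreover have "C (i + 4) = g ?x ?y \<or> g (w i) ?y = C (i + 4) \<or> g (w i) ?y = g ?x ?y"
    using star[of ?y "w (i + 5)" ?x] by (auto simp: cols)
  moreover have "C (i + 3) \<noteq> C (i + 4)" by simp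
  ultimately have "g ?x ?y \<in> {C (i + 3), C (i + 4)}" by (metis insertCI)
  with 1 show False by auto
qed

lemma chord:
  "g (w i) (w (i + 3)) \<in> {C (i - 1), C i, C (i + 2), C (i + 3)}"
proof -
  have "\<not> distinct [g (w i) (w (i + 3)), C (i - 1), C i, C (i + 2), C (i + 3)]"
    using no_barbell[of "w i" "w (i + 3)" "w (i - 1)" "w (i + 1)" "w (i + 2)" "w (i + 4)"]
    by (simp add: color_next color_prev)
  then show ?thesis by simp
qed

text \<open>The chord repeats the color of a cycle edge at \<open>w i\<close>; with
  \<open>w i x\<close> as leaf edge in place of that edge, any repetition in the barbell must
  involve \<open>w i x\<close>.\<close>

lemma chord_left:
  assumes "x \<in> V" "x \<notin> range w" "g (w i) (w (i + 3)) \<in> {C (i - 1), C i}"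
  shows "g (w i) x \<in> {C (i - 1), C i, C (i + 2), C (i + 3)}"
proof -
  have [simp]: "w j \<noteq> x" "x \<noteq> w j" for j using assms(2) by auto
  have "\<not> distinct [g (w i) (w (i + 3)), C (i - 1), g (w i) x, C (i + 2), C (i + 3)]"
    using assms(1) no_barbell[of "w i" "w (i + 3)" "w (i - 1)" x "w (i + 2)" "w (i + 4)"]
    by (simp add: color_next color_prev)
  moreover have "\<not> distinct [g (w i) (w (i + 3)), C i, g (w i) x, C (i + 2), C (i + 3)]"
    using assms(1) no_barbell[of "w i" "w (i + 3)" "w (i + 1)" x "w (i + 2)" "w (i + 4)"]
    by (simp add: color_next color_prev)
  ultimately show ?thesis
    using assms(3) by auto
qed

text \<open>The mirror image, with the ends of the chord exchanged.\<close>

lemma chord_right: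
  assumes "x \<in> V" "x \<notin> range w" "g (w i) (w (i + 3)) \<in> {C (i + 2), C (i + 3)}"
  shows "g (w (i + 3)) x \<in> {C (i - 1), C i, C (i + 2), C (i + 3)}"
proof -
  have [simp]: "w j \<noteq> x" "x \<noteq> w j" for j using assms(2) by auto
  have "\<not> distinct [g (w i) (w (i + 3)), C (i - 1), C i, C (i + 2), g (w (i + 3)) x]"
    using assms(1) no_barbell[of "w i" "w (i + 3)" "w (i - 1)" "w (i + 1)" "w (i + 2)" x]
    by (simp add: color_next color_prev)
  moreover have "\<not> distinct [g (w i) (w (i + 3)), C (i - 1), C i, C (i + 3), g (w (i + 3)) x]"
    using assms(1) no_barbell[of "w i" "w (i + 3)" "w (i - 1)" "w (i + 1)" "w (i + 4)" x]
    by (simp add: color_next color_prev)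
  ultimately show ?thesis
    using assms(3) by auto
qed

end

section \<open>An edge whose color is absent from the cycle vertices\<close>

text \<open>As a leaf edge at \<open>a\<close>, the edge \<open>a b\<close> shares its color with no
  edge that meets the cycle, so in a barbell with center \<open>w i a\<close> it never causes a
  repetition.\<close>

locale rainbow_cycle_edge = rainbow_cycle +
  fixes a b :: 'a
  assumes ab_in [simp]: "a \<in> V" "b \<in> V" and ab_neq [simp]: "a \<noteq> b"
    and ab_notin: "a \<notin> range w" "b \<notin> range w"
    and new_color: "x \<in> V \<Longrightarrow> x \<noteq> w i \<Longrightarrow> g (w i) x \<noteq> g a b"
begin

lemma ab_w [simp]: "w i \<noteq> a" "w i \<noteq> b" "a \<noteq> w i" "b \<noteq> w i"
  using ab_notin by auto

definition A :: "int \<Rightarrow> 'b" where "A i = g (w i) a"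

lemma color_a: "g (w i) a = A i" "g a (w i) = A i"
  by (simp_all add: A_def sym[of a])

lemma color_new [simp]: "A i \<noteq> g a b" "g a b \<noteq> A i" "C i \<noteq> g a b" "g a b \<noteq> C i"
  using new_color[of a i] new_color[of "w (i + 1)" i] by (auto simp: A_def C_def)

text \<open>Take the center \<open>w i a\<close>, the two cycle edges at \<open>w i\<close>, and
  \<open>a b\<close>, \<open>a (w j)\<close> as leaf edges: a repetition forces
  \<open>A i = A j\<close> or puts one of the two among the cycle colors at \<open>w i\<close>. The
  same holds at \<open>w j\<close>, and the two pairs of cycle colors are disjoint.\<close>

lemma nonadjacent:
  assumes "i + 1 < j" "j < i + 5"
  shows "A i = A j
    \<or> A i \<in> {C (i - 1), C i} \<and> A j \<in> {C (j - 1), C j}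
    \<or> A i \<in> {C (j - 1), C j} \<and> A j \<in> {C (i - 1), C i}"
proof -
  have "\<not> distinct [A i, C (i - 1), C i, g a b, A j]"
    using assms no_barbell[of "w i" a "w (i - 1)" "w (i + 1)" b "w j"]
    by (simp add: color_next color_prev color_a)
  moreover have "\<not> distinct [A j, C (j - 1), C j, g a b, A i]"
    using assms no_barbell[of "w j" a "w (j - 1)" "w (j + 1)" b "w i"]
    by (simp add: color_next color_prev color_a)
  moreover have "{C (i - 1), C i} \<inter> {C (j - 1), C j} = {}"
    using assms by simp
  ultimately show ?thesis by auto
qed

text \<open>The color of the chord settles one end, and \<open>nonadjacent\<close> carries the claim
  to the other.\<close>

lemma chord_ends:
  shows "A i \<in> {C (i - 1), C i, C (i + 2), C (i + 3)}"
    and "A (i + 3) \<in> {C (i - 1), C i, C (i + 2), C (i + 3)}"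
proof -
  have "A i \<in> {C (i - 1), C i, C (i + 2), C (i + 3)}
      \<or> A (i + 3) \<in> {C (i - 1), C i, C (i + 2), C (i + 3)}"
    using chord[of i] chord_left[of a i] chord_right[of a i] ab_notin unfolding color_a
    by (metis ab_in(1) insertE insertI1 insertI2)
  moreover have "A i = A (i + 3)
      \<or> A i \<in> {C (i - 1), C i} \<and> A (i + 3) \<in> {C (i + 2), C (i + 3)}
      \<or> A i \<in> {C (i + 2), C (i + 3)} \<and> A (i + 3) \<in> {C (i - 1), C i}"
    using nonadjacent[of i "i + 3"] by (simp add: algebra_simps)
  ultimately show "A i \<in> {C (i - 1), C i, C (i + 2), C (i + 3)}"
    and "A (i + 3) \<in> {C (i - 1), C i, C (i + 2), C (i + 3)}"
    by (elim disjE; auto)+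
qed

lemma own_colors: "A i \<in> {C (i - 1), C i}"
proof (rule ccontr)
  assume neg: "A i \<notin> {C (i - 1), C i}"
  then have "A i \<in> {C (i + 2), C (i + 3)}"
    using chord_ends(1)[of i] by auto
  \<comment> \<open>\<open>w (i + 2)\<close> ends the chord from \<open>w (i - 1)\<close>;
    comparison with it leaves only \<open>C (i + 2)\<close> for \<open>A i\<close>.\<close>
  moreover have "A (i + 2) \<in> {C (i - 2), C (i - 1), C (i + 1), C (i + 2)}"
    using chord_ends(2)[of "i - 1"] by (simp add: algebra_simps)
  ultimately have "A i = C (i + 2)"
    using nonadjacent[of i "i + 2"] neg by auto
  \<comment> \<open>The chord from \<open>w (i - 2)\<close> to \<open>w (i + 1)\<close> excludes
    this last color. All indices compared differ by at most 5.\<close>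
  moreover have "A (i - 2) \<in> {C (i - 3), C (i - 2), C i, C (i + 1)}"
    using chord_ends(1)[of "i - 2"] by (simp add: algebra_simps)
  ultimately show False
    using nonadjacent[of "i - 2" i] by auto
qed

lemma contradiction: False
proof -
  let ?d = "g (w 0) (w 3)"
  have d [simp]: "g (w 3) (w 0) = ?d" "?d \<noteq> g a b" "g a b \<noteq> ?d"
    using sym[of "w 3" "w 0"] new_color[of "w 3" 0] by auto
  consider "?d \<in> {C 2, C 3}" | "?d \<in> {C (-1), C 0}"
    using chord[of 0] by auto
  then show False
  proof cases
    case 1
    \<comment> \<open>One of these four barbells is rainbow: \<open>A 0\<close> is one of
      \<open>C (-1)\<close>, \<open>C 0\<close>, so the other is free for a leaf edge at
      \<open>w 0\<close>, and \<open>A 2\<close>, \<open>A 4\<close> lie in disjoint pairs, so one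
      of them differs from \<open>?d\<close>.\<close>
    have "\<not> distinct [A 0, ?d, C 0, g a b, A 2]" "\<not> distinct [A 0, ?d, C 0, g a b, A 4]"
      using no_barbell[of "w 0" a "w 3" "w 1" b "w 2"] no_barbell[of "w 0" a "w 3" "w 1" b "w 4"]
      by (simp_all add: color_next color_prev color_a)
    moreover have "\<not> distinct [A 0, ?d, C (-1), g a b, A 2]"
      "\<not> distinct [A 0, ?d, C (-1), g a b, A 4]"
      using no_barbell[of "w 0" a "w 3" "w (-1)" b "w 2"]
        no_barbell[of "w 0" a "w 3" "w (-1)" b "w 4"]
      by (simp_all add: color_next color_prev color_a)
    ultimately show False
      using 1 own_colors[of 0] own_colors[of 2] own_colors[of 4] by (elim insertE emptyE) simp_all
  next
    case 2
    \<comment> \<open>The first case under the reflection of indices \<open>i\<close> to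
      \<open>3 - i\<close>.\<close>
    have "\<not> distinct [A 3, ?d, C 3, g a b, A 1]" "\<not> distinct [A 3, ?d, C 3, g a b, A (-1)]"
      using no_barbell[of "w 3" a "w 0" "w 4" b "w 1"] no_barbell[of "w 3" a "w 0" "w 4" b "w (-1)"]
      by (simp_all add: color_next color_prev color_a)
    moreover have "\<not> distinct [A 3, ?d, C 2, g a b, A 1]"
      "\<not> distinct [A 3, ?d, C 2, g a b, A (-1)]"
      using no_barbell[of "w 3" a "w 0" "w 2" b "w 1"] no_barbell[of "w 3" a "w 0" "w 2" b "w (-1)"]
      by (simp_all add: color_next color_prev color_a)
    ultimately show False
      using 2 own_colors[of 3] own_colors[of 1] own_colors[of "-1"] by (elim insertE emptyE) simp_all
  qed
qed

end

section \<open>Rainbow copies as injections\<close>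

lemma isomorphic_sym:
  assumes "simple_graph G" "isomorphic G H"
  shows "isomorphic H G"
proof -
  obtain f where f: "bij_betw f (verts G) (verts H)" "(\<lambda>e. f ` e) ` edges G = edges H"
    using assms(2) by (auto simp: isomorphic_def)
  let ?h = "inv_into (verts G) f"
  have "?h ` f ` e = e" if "e \<in> edges G" for e
    using that assms(1) f(1)
    by (intro inv_into_image_cancel) (auto simp: simple_graph_def bij_betw_def)
  then have "(\<lambda>e. ?h ` e) ` edges H = edges G"
    by (simp add: f(2)[symmetric] image_image)
  then show ?thesis
    using bij_betw_inv_into[OF f(1)] by (auto simp: isomorphic_def)
qed

text \<open>In a complete host every injection of \<open>verts H\<close> yields a copy of
  \<open>H\<close>, so no adjacency remains to be checked.\<close>

lemma rainbow_free_iff: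
  assumes "complete_graph G" "simple_graph H"
  shows "rainbow_free H G c \<longleftrightarrow>
    (\<forall>h. inj_on h (verts H) \<and> h ` verts H \<subseteq> verts G \<longrightarrow> \<not> inj_on (\<lambda>e. c (h ` e)) (edges H))"
    (is "?L \<longleftrightarrow> ?R")
proof
  assume L: ?L
  show ?R
  proof (intro allI impI notI)
    fix h assume h: "inj_on h (verts H) \<and> h ` verts H \<subseteq> verts G"
      and inj: "inj_on (\<lambda>e. c (h ` e)) (edges H)"
    define S where "S = Graph (h ` verts H) ((\<lambda>e. h ` e) ` edges H)"
    have sub: "h ` e \<subseteq> h ` verts H \<and> card (h ` e) = 2" if "e \<in> edges H" for e
      using that assms(2) h
      by (auto simp: simple_graph_def card_image inj_on_subset)
    have "subgraph S G"
      using sub h assms by (auto simp: subgraph_def S_def simple_graph_def complete_graph_def)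
    moreover have "isomorphic H S"
      using h by (auto simp: isomorphic_def S_def bij_betw_def)
    then have "isomorphic S H"
      by (rule isomorphic_sym[OF assms(2)])
    moreover have "rainbow c S"
      using inj by (auto simp: rainbow_def S_def inj_on_def)
    ultimately show False
      using L by (auto simp: rainbow_free_def)
  qed
next
  assume R: ?R
  show ?L
    unfolding rainbow_free_def
  proof clarify
    fix S assume S: "subgraph S G" "isomorphic S H" "rainbow c S"
    then have "isomorphic H S"
      by (auto simp: subgraph_def intro: isomorphic_sym)
    then obtain h where h: "bij_betw h (verts H) (verts S)" "(\<lambda>e. h ` e) ` edges H = edges S"
      by (auto simp: isomorphic_def)
    have "inj_on (\<lambda>e. h ` e) (edges H)"
      using h(1) assms(2)
      by (intro inj_on_subset[OF inj_on_image_Pow[of h "verts H"]])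
        (auto simp: simple_graph_def bij_betw_def)
    then have "inj_on (c \<circ> (\<lambda>e. h ` e)) (edges H)"
      using S(3) h(2) by (intro comp_inj_on) (auto simp: rainbow_def)
    then have "inj_on (\<lambda>e. c (h ` e)) (edges H)"
      by (simp add: o_def)
    then show False
      using R S(1) h(1) by (auto simp: subgraph_def bij_betw_def)
  qed
qed

lemma rainbow_free_barbell_iff:
  assumes "complete_graph G"
  shows "rainbow_free barbell G c \<longleftrightarrow>
    (\<forall>x y p q r s. {x, y, p, q, r, s} \<subseteq> verts G \<and> distinct [x, y, p, q, r, s] \<longrightarrow>
      \<not> distinct [c {x, y}, c {x, p}, c {x, q}, c {y, r}, c {y, s}])"
    (is "?L \<longleftrightarrow> ?R")
proof
  assume L: ?L
  show ?R
  proof (intro allI impI)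
    fix x y p q r s
    assume d: "{x, y, p, q, r, s} \<subseteq> verts G \<and> distinct [x, y, p, q, r, s]"
    define h where "h = (\<lambda>i. [x, y, p, q, r, s] ! i)"
    have vals: "h 0 = x" "h 1 = y" "h 2 = p" "h 3 = q" "h 4 = r" "h 5 = s"
      by (simp_all add: h_def)
    have "inj_on h {..<6}"
      unfolding h_def using d by (intro inj_on_nth) auto
    moreover have "{..<6} = {0, 1, 2, 3, 4, 5::nat}" by auto
    then have "h ` {..<6} \<subseteq> verts G"
      using d by (simp add: vals vals[unfolded One_nat_def])
    ultimately have "\<not> inj_on (\<lambda>e. c (h ` e)) (edges barbell)"
      using L rainbow_free_iff[OF assms simple_graph_barbell] by (auto simp: barbell_def)
    then show "\<not> distinct [c {x, y}, c {x, p}, c {x, q}, c {y, r}, c {y, s}]"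
      by (auto simp: barbell_def vals vals[unfolded One_nat_def])
  qed
next
  assume R: ?R
  have "\<not> inj_on (\<lambda>e. c (h ` e)) (edges barbell)"
    if h: "inj_on h (verts barbell)" "h ` verts barbell \<subseteq> verts G" for h
  proof
    assume inj: "inj_on (\<lambda>e. c (h ` e)) (edges barbell)"
    have neq: "h i = h j \<longleftrightarrow> i = j" if "i < 6" "j < 6" for i j
      using h(1) that by (auto simp: barbell_def inj_on_def)
    have "h i \<in> verts G" if "i < 6" for i
      using h(2) that by (auto simp: barbell_def)
    moreover have "distinct [h 0, h 1, h 2, h 3, h 4, h 5]"
      by (simp add: neq)
    moreover have "distinct (map (\<lambda>e. c (h ` e)) [{0, 1}, {0, 2}, {0, 3}, {1, 4}, {1, 5}])"
      unfolding distinct_map using inj by (auto simp: barbell_def doubleton_eq_iff)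
    ultimately show False
      using R[rule_format, of "h 0" "h 1" "h 2" "h 3" "h 4" "h 5"] by auto
  qed
  then show ?L
    using rainbow_free_iff[OF assms simple_graph_barbell] by blast
qed

section \<open>Cycles of length at least six\<close>

text \<open>Lets edges be indexed by their first vertex; for \<open>k = 2\<close> both indices would
  give the same edge.\<close>

lemma cycle_edge_inj:
  fixes k m n :: nat
  assumes "k \<ge> 3" "m < k" "n < k" "{m, (m + 1) mod k} = {n, (n + 1) mod k}"
  shows "m = n"
  using assms by (auto simp: doubleton_eq_iff mod_Suc split: if_splits)

lemma barbell_le_cycle:
  assumes k: "k \<ge> 6"
  shows "barbell \<preceq> cycle_graph k"
  unfolding rainbow_le_def
\<comment> \<open>Each of the \<open>k\<close> cycle vertices sees at most 6 colors, so one color is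
  left over.\<close>
proof (intro exI[of _ "6 * k + 1"] conjI allI impI)
  fix G :: "nat graph" and c
  assume asm: "complete_graph G \<and> 6 * k + 1 \<le> card (c ` edges G) \<and> rainbow_free barbell G c"
  then have G: "complete_graph G" by simp
  show "rainbow_free (cycle_graph k) G c"
    unfolding rainbow_free_iff[OF G simple_graph_cycle[of k, OF order_trans[OF _ k], simplified]]
  proof (intro allI impI notI)
    fix h assume "inj_on h (verts (cycle_graph k)) \<and> h ` verts (cycle_graph k) \<subseteq> verts G"
      and inj: "inj_on (\<lambda>e. c (h ` e)) (edges (cycle_graph k))"
    then have h: "inj_on h {..<k}" "h ` {..<k} \<subseteq> verts G"
      by (auto simp: cycle_graph_def)
    define w where "w i = h (nat (i mod int k))" for i :: int
    define g where "g x y = c {x, y}" for x y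
    have mod_lt: "nat (i mod int k) < k" for i
      using k by (simp add: nat_less_iff)
    \<comment> \<open>Here \<open>k \<ge> 6\<close> enters: a nonzero multiple of \<open>k\<close>
      has absolute value at least 6.\<close>
    have mod_eq: "i = j"
      if "nat (i mod int k) = nat (j mod int k)" "i < j + 6" "j < i + 6" for i j
    proof -
      have "i mod int k = j mod int k"
        using that(1) k by (simp add: eq_nat_nat_iff)
      then have "int k dvd i - j"
        by (simp add: mod_eq_dvd_iff)
      then show ?thesis
        using dvd_imp_le_int[of "i - j" "int k"] that k by linarith
    qed
    have w_edge: "{w i, w (i + 1)} = h ` {nat (i mod int k), (nat (i mod int k) + 1) mod k}" for i
    proof -
      have "int (nat ((i + 1) mod int k)) = int ((nat (i mod int k) + 1) mod k)"
        using k by (simp add: zmod_int mod_simps add.commute)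
      then show ?thesis
        unfolding w_def by (metis image_empty image_insert of_nat_eq_iff)
    qed
    interpret rainbow_cycle "verts G" g w
    proof
      show "g x y = g y x" for x y
        by (simp add: g_def insert_commute)
      show "\<not> distinct [g x y, g x p, g x q, g y r, g y s]"
        if "{x, y, p, q, r, s} \<subseteq> verts G" "distinct [x, y, p, q, r, s]" for x y p q r s
        using rainbow_free_barbell_iff[OF G, THEN iffD1, rule_format, OF _ conjI[OF that]] asm
        unfolding g_def by simp
      show "w i \<in> verts G" for i
        using h(2) mod_lt by (auto simp: w_def)
      show "w i = w j \<longleftrightarrow> i = j" if "i < j + 6" "j < i + 6" for i j
        using that mod_eq h(1) mod_lt unfolding w_def by (metis inj_on_eq_iff lessThan_iff)
      show "g (w i) (w (i + 1)) = g (w j) (w (j + 1)) \<longleftrightarrow> i = j"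
        if ij: "i < j + 6" "j < i + 6" for i j
      proof
        assume "g (w i) (w (i + 1)) = g (w j) (w (j + 1))"
        then have "{nat (i mod int k), (nat (i mod int k) + 1) mod k}
            = {nat (j mod int k), (nat (j mod int k) + 1) mod k}"
          unfolding g_def w_edge
          using mod_lt by (intro inj_onD[OF inj]) (auto simp: cycle_graph_def)
        then show "i = j"
          using cycle_edge_inj[OF _ mod_lt mod_lt] k mod_eq ij by auto
      qed simp
    qed
    have fin: "finite (verts G)"
      using G by (simp add: complete_graph_def)
    define U where "U = (\<Union>m<k. g (w (int m)) ` (verts G - {w (int m)}))"
    have "card U \<le> (\<Sum>m<k. card (g (w (int m)) ` (verts G - {w (int m)})))"
      unfolding U_def by (rule card_UN_le) simp
    also have "\<dots> \<le> (\<Sum>m<k. 6)"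
      by (intro sum_mono few_colors_at_cycle fin)
    finally have "card U < card (c ` edges G)"
      using asm by simp
    moreover have "finite U" using fin by (simp add: U_def)
    ultimately have "\<not> c ` edges G \<subseteq> U"
      by (metis card_mono leD)
    then obtain e where e: "e \<in> edges G" "c e \<notin> U" by blast
    have "e \<subseteq> verts G" "card e = 2"
      using e(1) G by (simp_all add: complete_graph_def)
    moreover obtain a b where "e = {a, b}" "a \<noteq> b"
      using \<open>card e = 2\<close> by (metis card_2_iff)
    ultimately have ab: "a \<in> verts G" "b \<in> verts G" "a \<noteq> b" "c {a, b} \<notin> U"
      using e(2) by simp_all
    have new: "g (w i) x \<noteq> g a b" if "x \<in> verts G" "x \<noteq> w i" for i x
    proof -
      have "\<exists>m<k. w (int m) = w i"
        using mod_lt[of i] by (intro exI[of _ "nat (i mod int k)"]) (simp add: w_def)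
      then obtain m where m: "m < k" "w (int m) = w i" by blast
      have "g (w i) x \<in> g (w (int m)) ` (verts G - {w (int m)})"
        unfolding m(2) using that by blast
      then have "g (w i) x \<in> U"
        using m(1) unfolding U_def by blast
      then show ?thesis
        using ab(4) by (auto simp: g_def)
    qed
    interpret rainbow_cycle_edge "verts G" g w a b
    proof
      \<comment> \<open>Were \<open>a\<close> on the cycle, \<open>a b\<close> would itself be an
        edge at a cycle vertex.\<close>
      show "a \<notin> range w"
        using new[of b] ab(2,3) by (metis rangeE)
      show "b \<notin> range w"
        using new[of a] ab(1,3) sym[of a b] by (metis rangeE)
    qed (use ab new in auto)
    show False by (rule contradiction)
  qed
qed simp

section \<open>Cycles of length three to five\<close>

lemma cycle_graph_edge_iff:
  assumes "k > 0"
  shows "{x, y} \<in> edges (cycle_graph k) \<longleftrightarrow>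
    x < k \<and> y < k \<and> (y = (x + 1) mod k \<or> x = (y + 1) mod k)"
  using assms by (auto simp: cycle_graph_def doubleton_eq_iff)

lemma not_barbell_le_cycle:
  assumes k: "3 \<le> k" "k \<le> 5"
  shows "\<not> barbell \<preceq> cycle_graph k"
proof
  assume "barbell \<preceq> cycle_graph k"
  then obtain t where t: "\<And>(G :: nat graph) c. complete_graph G \<Longrightarrow> card (c ` edges G) \<ge> t
      \<Longrightarrow> rainbow_free barbell G c \<Longrightarrow> rainbow_free (cycle_graph k) G c"
    unfolding rainbow_le_def by blast
  \<comment> \<open>The cycle takes the first \<open>k\<close> vertices; the other
    \<open>2 * t\<close> form \<open>t\<close> disjoint edges, which supply \<open>t\<close>
    colors.\<close>
  define V where "V = {..<k + 2 * t}"
  define G where "G = Graph V {e. e \<subseteq> V \<and> card e = 2}"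
  have G: "complete_graph G"
    by (simp add: complete_graph_def G_def V_def)
  define matching where "matching = (\<lambda>j. {k + 2 * j, k + 2 * j + 1}) ` {..<t}"
  define M where "M = edges (cycle_graph k) \<union> matching"
  have "finite M"
    by (simp add: M_def matching_def cycle_graph_def)
  then obtain f :: "nat set \<Rightarrow> nat" where f: "inj_on f M"
    using finite_imp_inj_to_nat_seg by blast
  \<comment> \<open>\<open>Suc\<close> reserves the color 0 for the edges outside
    \<open>M\<close>.\<close>
  define c where "c e = (if e \<in> M then Suc (f e) else 0)" for e
  have inj: "inj_on c M"
    using f by (auto simp: inj_on_def c_def)
  have "M \<subseteq> edges G"
    using simple_graph_cycle[OF k(1)]
    by (auto simp: M_def matching_def G_def V_def simple_graph_def cycle_graph_def trans_less_add1)
  have "inj_on (\<lambda>j. {k + 2 * j, k + 2 * j + 1}) {..<t}"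
    by (auto simp: inj_on_def doubleton_eq_iff)
  then have "t = card matching"
    by (simp add: matching_def card_image)
  also have "\<dots> \<le> card M"
    using \<open>finite M\<close> by (intro card_mono) (auto simp: M_def)
  also have "\<dots> = card (c ` M)"
    using inj by (simp add: card_image)
  also have "\<dots> \<le> card (c ` edges G)"
    using \<open>M \<subseteq> edges G\<close> by (intro card_mono) (auto simp: G_def V_def)
  finally have many: "card (c ` edges G) \<ge> t" .

  have mem: "x < k \<and> y < k \<and> (y = (x + 1) mod k \<or> x = (y + 1) mod k)
      \<or> k \<le> x \<and> k \<le> y \<and> x \<noteq> y \<and> (x - k) div 2 = (y - k) div 2" if "{x, y} \<in> M" for x y
    using that k by (auto simp: M_def cycle_graph_edge_iff matching_def doubleton_eq_iff)
  have pair: "y = z" if "k \<le> x" "{x, y} \<in> M" "{x, z} \<in> M" for x y z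
  proof -
    have "k \<le> y" "x \<noteq> y" "(x - k) div 2 = (y - k) div 2"
      and "k \<le> z" "x \<noteq> z" "(x - k) div 2 = (z - k) div 2"
      using mem[OF that(2)] mem[OF that(3)] that(1) by auto
    moreover have "l = n" if "m div 2 = l div 2" "m div 2 = n div 2" "m \<noteq> l" "m \<noteq> n" for l m n :: nat
      using that by presburger
    ultimately have "y - k = z - k"
      using that(1) eq_diff_iff by metis
    then show ?thesis
      using \<open>k \<le> y\<close> \<open>k \<le> z\<close> by simp
  qed
  have two: "x < k \<and> y < k \<and> z < k" if "{x, y} \<in> M" "{x, z} \<in> M" "y \<noteq> z" for x y z
    using pair[of x y z] mem[of x y] mem[of x z] that by auto
  have succ_inj: "y = z" if "y < k" "z < k" "(y + 1) mod k = (z + 1) mod k" for y z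
    using that by (auto simp: mod_Suc split: if_splits)
  \<comment> \<open>Of three neighbors on the cycle, two are both successors or both predecessors of
    \<open>x\<close>.\<close>
  have three: "y = z \<or> y = u \<or> z = u" if "{x, y} \<in> M" "{x, z} \<in> M" "{x, u} \<in> M" for x y z u
  proof (cases "x < k")
    case True
    then show ?thesis
      using mem[OF that(1)] mem[OF that(2)] mem[OF that(3)] succ_inj by (metis leD)
  next
    case False
    then show ?thesis
      using pair[of x y z] that by auto
  qed
  have free: "\<not> distinct [c {x, y}, c {x, p}, c {x, q}, c {y, r}, c {y, s}]"
    if d: "distinct [x, y, p, q, r, s]" for x y p q r s
  proof
    assume col: "distinct [c {x, y}, c {x, p}, c {x, q}, c {y, r}, c {y, s}]"
    have "{x, y} \<notin> M \<or> {x, p} \<notin> M \<or> {x, q} \<notin> M" "{x, y} \<notin> M \<or> {y, r} \<notin> M \<or> {y, s} \<notin> M"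
      using three[of x y p q] three[of y x r s] d by (auto simp: insert_commute)
    \<comment> \<open>At most one barbell edge has color 0, yet each center has an edge outside
      \<open>M\<close>; hence it is the shared edge \<open>{x, y}\<close>.\<close>
    then have "{x, p} \<in> M" "{x, q} \<in> M" "{y, r} \<in> M" "{y, s} \<in> M"
      using col by (auto simp: c_def split: if_splits)
    then have "set [x, y, p, q, r, s] \<subseteq> {..<k}"
      using two[of x p q] two[of y r s] d by auto
    then have "card (set [x, y, p, q, r, s]) \<le> k"
      using card_mono[of "{..<k}"] by fastforce
    then show False
      using distinct_card[OF d] k by simp
  qed
  have "rainbow_free barbell G c"
    unfolding rainbow_free_barbell_iff[OF G] by (intro allI impI, elim conjE, rule free)
  then have "rainbow_free (cycle_graph k) G c"
    by (rule t[OF G many])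
  moreover have "id ` verts (cycle_graph k) \<subseteq> verts G"
    by (auto simp: cycle_graph_def G_def V_def)
  moreover have "inj_on (\<lambda>e. c (id ` e)) (edges (cycle_graph k))"
    using inj by (auto simp: M_def intro: inj_on_subset)
  ultimately show False
    using rainbow_free_iff[OF G simple_graph_cycle[OF k(1)], THEN iffD1, rule_format, of c id]
    by simp
qed

theorem theorem14:
  shows "(\<forall>k\<ge>6. barbell \<preceq> cycle_graph k) \<and> (\<forall>k\<in>{3, 4, 5}. \<not> barbell \<preceq> cycle_graph k)"
  by (auto simp: barbell_le_cycle not_barbell_le_cycle)

end
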